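(* Let $\mathbb{A}$ be the Alexandroff-Urysohn double arrow space and let $\mathfrak{c}=2^{\aleph_0}$. Then $\mathbb{A}$ has $\mathfrak{c}$ types of countable dense subsets.
   Context: The Alexandroff-Urysohn double arrow space: let $\mathbb{A}_0=(0,1]\times\{0\}$, $\mathbb{A}_1=[0,1)\times\{1\}$ and $\mathbb{A}=\mathbb{A}_0\cup\mathbb{A}_1$, with the strict lexicographic order $\langle x,t\rangle<\langle y,s\rangle$ iff $x<y$, or $x=y$ and $t<s$; $\mathbb{A}$ carries the order topology. For a separable space $X$ and a cardinal $\kappa$, $X$ has $\kappa$ types of countable dense subsets if $\kappa$ is the minimum cardinal such that there is a collection $\mathcal{D}$ of countable dense subsets of $X$ with $|\mathcal{D}|=\kappa$ and such that for every countable dense subset $E\subset X$ there are $D\in\mathcal{D}$ and a homeomorphism $h:X\to X$ with $h[D]=E$. *)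

theory Defs
  imports "HOL-Analysis.Analysis"
begin

unbundle cardinal_syntax

definition countable_dense_in :: "'a topology \<Rightarrow> 'a set \<Rightarrow> bool" where
  "countable_dense_in X D \<longleftrightarrow>
     countable D \<and> D \<subseteq> topspace X \<and> X closure_of D = topspace X"

definition separable_topology :: "'a topology \<Rightarrow> bool" where
  "separable_topology X \<longleftrightarrow> (\<exists>D. countable_dense_in X D)"

definition represents_countable_dense :: "'a topology \<Rightarrow> 'a set set \<Rightarrow> bool" where
  "represents_countable_dense X \<D> \<longleftrightarrow>
     (\<forall>D\<in>\<D>. countable_dense_in X D) \<and>
     (\<forall>E. countable_dense_in X E \<longrightarrow>
        (\<exists>D\<in>\<D>. \<exists>h. homeomorphic_map X X h \<and> h ` D = E))"

(* Cardinals are cardinal orders up to =o, so kappa may live on any type.  The last conjunct says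
   that kappa is minimal among the cardinalities of representing collections. *)
definition has_types_of_countable_dense :: "'a topology \<Rightarrow> 'k rel \<Rightarrow> bool" where
  "has_types_of_countable_dense X \<kappa> \<longleftrightarrow>
     separable_topology X \<and> Card_order \<kappa> \<and>
     (\<exists>\<D>. represents_countable_dense X \<D> \<and> |\<D>| =o \<kappa>) \<and>
     (\<forall>\<D>. represents_countable_dense X \<D> \<longrightarrow> \<kappa> \<le>o |\<D>| )"

typedef double_arrow =
  "({0<..1} \<times> {0}) \<union> ({0..<1} \<times> {1}) :: (real \<times> nat) set"
  morphisms da_pair Abs_double_arrow
proof
  show "(1, 0) \<in> (({0<..1} \<times> {0}) \<union> ({0..<1} \<times> {1}) :: (real \<times> nat) set)"
    by simp
qed

instantiation double_arrow :: linorder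
begin

definition less_double_arrow :: "double_arrow \<Rightarrow> double_arrow \<Rightarrow> bool" where
  "p < q \<longleftrightarrow> fst (da_pair p) < fst (da_pair q) \<or>
     (fst (da_pair p) = fst (da_pair q) \<and> snd (da_pair p) < snd (da_pair q))"

definition less_eq_double_arrow :: "double_arrow \<Rightarrow> double_arrow \<Rightarrow> bool" where
  "p \<le> q \<longleftrightarrow> p < q \<or> p = (q :: double_arrow)"

instance
proof
  fix p q r :: double_arrow
  show "p < q \<longleftrightarrow> p \<le> q \<and> \<not> q \<le> p"
    by (auto simp: less_eq_double_arrow_def less_double_arrow_def)
  show "p \<le> p"
    by (simp add: less_eq_double_arrow_def)
  show "p \<le> q \<Longrightarrow> q \<le> r \<Longrightarrow> p \<le> r"
    by (auto simp: less_eq_double_arrow_def less_double_arrow_def)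
  show "p \<le> q \<Longrightarrow> q \<le> p \<Longrightarrow> p = q"
    by (auto simp: less_eq_double_arrow_def less_double_arrow_def)
  show "p \<le> q \<or> q \<le> p"
    by (auto simp: less_eq_double_arrow_def less_double_arrow_def prod_eq_iff
        simp flip: da_pair_inject)
qed

end

instantiation double_arrow :: linorder_topology
begin

definition open_double_arrow :: "double_arrow set \<Rightarrow> bool" where
  "open_double_arrow = generate_topology (range (\<lambda>a. {..<a}) \<union> range (\<lambda>a. {a<..}))"

instance
  by standard (rule open_double_arrow_def)

end

end

theory Submission
  imports Defs
begin

text \<open>
  Write $x^-$, $x^+$ for the two copies of $x$. By a Baire category argument every homeomorphism $h$ of
  the double arrow space is monotone on some subinterval of any given nonempty open set, so there it
  maps twins $x^-, x^+$ to twins. Split the space into disjoint open sets $U$, $V$ with dense union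
  such that the closed set $F = \overline U \cap \overline V$ has a point $p_n$ of each finite
  Cantor-Bendixson rank $n$. For $S \subseteq \mathbb{N}$ let $E_S$ consist of both copies of the
  rationals within $U$, only the upper copies within $V$, and the points $p_n$ with $n \in S$.
  A homeomorphism taking $E_S$ to $E_T$ preserves $\overline U$ and $\overline V$, hence $F$ and the
  ranks of its points, and $E_S \cap F = \{p_n : n \in S\}$ then gives $S = T$.
\<close>

subsection \<open>The topology of the double arrow space\<close>

abbreviation pos :: "double_arrow \<Rightarrow> real" where "pos p \<equiv> fst (da_pair p)"
abbreviation side :: "double_arrow \<Rightarrow> nat" where "side p \<equiv> snd (da_pair p)"

definition lower :: "real \<Rightarrow> double_arrow" where "lower x = Abs_double_arrow (x, 0)"
definition upper :: "real \<Rightarrow> double_arrow" where "upper x = Abs_double_arrow (x, 1)"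

lemma da_pair_lower: "0 < x \<Longrightarrow> x \<le> 1 \<Longrightarrow> da_pair (lower x) = (x, 0)"
  and da_pair_upper: "0 \<le> x \<Longrightarrow> x < 1 \<Longrightarrow> da_pair (upper x) = (x, 1)"
  by (simp_all add: lower_def upper_def Abs_double_arrow_inverse)

lemma double_arrow_cases:
  obtains (lower) x where "0 < x" "x \<le> 1" "p = lower x"
  | (upper) x where "0 \<le> x" "x < 1" "p = upper x"
proof (cases "da_pair p")
  case (Pair x i)
  then have "p = Abs_double_arrow (x, i)"
    by (metis da_pair_inverse)
  with Pair show ?thesis
    using da_pair[of p] that unfolding lower_def upper_def by auto
qed

lemma pos_bounds: "0 \<le> pos p" "pos p \<le> 1"
  by (cases p rule: double_arrow_cases; simp add: da_pair_lower da_pair_upper)+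

lemma side_at_ends: "pos p = 0 \<Longrightarrow> side p = 1" "pos p = 1 \<Longrightarrow> side p = 0"
  by (cases p rule: double_arrow_cases; simp add: da_pair_lower da_pair_upper)+

lemma less_da_iff: "p < q \<longleftrightarrow> pos p < pos q \<or> pos p = pos q \<and> side p = 0 \<and> side q = 1"
  by (cases p rule: double_arrow_cases; cases q rule: double_arrow_cases;
      simp add: less_double_arrow_def da_pair_lower da_pair_upper)

lemma da_eq_iff: "p = q \<longleftrightarrow> pos p = pos q \<and> side p = side q"
  by (metis da_pair_inject prod_eq_iff)

lemma side_eq: "side p = 0 \<or> side p = 1"
  by (cases p rule: double_arrow_cases; simp add: da_pair_lower da_pair_upper)

lemma le_da_iff: "p \<le> q \<longleftrightarrow> pos p < pos q \<or> pos p = pos q \<and> (side p = 0 \<or> side q = 1)"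
  unfolding le_less less_da_iff da_eq_iff using side_eq[of p] side_eq[of q] by auto

text \<open>The clopen interval from $a^+$ to $b^-$.\<close>
definition clint :: "real \<Rightarrow> real \<Rightarrow> double_arrow set" where
  "clint a b = {p. (a < pos p \<or> pos p = a \<and> side p = 1) \<and> (pos p < b \<or> pos p = b \<and> side p = 0)}"

text \<open>The jump from \<open>lower a\<close> to \<open>upper a\<close> turns each closed
  half-line at the cut into an open ray. For \<open>a\<close> outside (0,1) at most one twin exists
  and the sets are everything or empty, so no bounds on \<open>a\<close> are needed later.\<close>

lemma clopen_halfline:
  "open {p. a < pos p \<or> pos p = a \<and> side p = 1}" (is "open ?R")
  "open {p. pos p < a \<or> pos p = a \<and> side p = 0}" (is "open ?L")
proof -
  consider "a \<le> 0" | "0 < a" "a < 1" | "1 \<le> a" by linarith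
  then have "open ?R \<and> open ?L"
  proof cases
    case 1
    have "a < pos p \<or> pos p = a \<and> side p = 1" "\<not> (pos p < a \<or> pos p = a \<and> side p = 0)" for p
      using 1 pos_bounds(1)[of p] side_at_ends(1)[of p] by linarith+
    then have "?R = UNIV" "?L = {}" by auto
    then show ?thesis by (simp del: Collect_empty_eq Collect_const)
  next
    case 2
    then have "?R = {lower a<..}" "?L = {..<upper a}"
      using side_eq by (auto simp: less_da_iff da_pair_lower da_pair_upper)
    then show ?thesis by (simp del: Collect_empty_eq Collect_const)
  next
    case 3
    have "pos p < a \<or> pos p = a \<and> side p = 0" "\<not> (a < pos p \<or> pos p = a \<and> side p = 1)" for p
      using 3 pos_bounds(2)[of p] side_at_ends(2)[of p] by linarith+
    then have "?R = {}" "?L = UNIV" by auto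
    then show ?thesis by (simp del: Collect_empty_eq Collect_const)
  qed
  then show "open ?R" "open ?L" by auto
qed

lemma open_clint: "open (clint a b)"
  unfolding clint_def Collect_conj_eq by (intro open_Int clopen_halfline)

lemma closed_clint: "closed (clint a b)"
proof -
  have "- clint a b = {p. b < pos p \<or> pos p = b \<and> side p = 1} \<union> {p. pos p < a \<or> pos p = a \<and> side p = 0}"
  proof (rule set_eqI)
    show "p \<in> - clint a b \<longleftrightarrow> p \<in> {p. b < pos p \<or> pos p = b \<and> side p = 1} \<union> {p. pos p < a \<or> pos p = a \<and> side p = 0}" for p
      using side_eq[of p] by (auto simp: clint_def)
  qed
  then show ?thesis
    unfolding closed_def by (simp only:) (intro open_Un clopen_halfline)
qed

lemma clint_mono: "a \<le> c \<Longrightarrow> d \<le> b \<Longrightarrow> clint c d \<subseteq> clint a b"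
  by (auto simp: clint_def)

lemma clint_convex: "u \<in> clint a b \<Longrightarrow> v \<in> clint a b \<Longrightarrow> u < r \<Longrightarrow> r < v \<Longrightarrow> r \<in> clint a b"
  unfolding clint_def mem_Collect_eq less_da_iff by linarith

lemma upper_in_clint: "0 \<le> x \<Longrightarrow> x < 1 \<Longrightarrow> upper x \<in> clint a b \<longleftrightarrow> a \<le> x \<and> x < b"
  by (auto simp: clint_def da_pair_upper)

lemma lower_in_clint: "0 < x \<Longrightarrow> x \<le> 1 \<Longrightarrow> lower x \<in> clint a b \<longleftrightarrow> a < x \<and> x \<le> b"
  by (auto simp: clint_def da_pair_lower)

lemma clint_UNIV: "clint 0 1 = UNIV"
proof -
  have "p \<in> clint 0 1" for p
    by (cases p rule: double_arrow_cases) (auto simp: lower_in_clint upper_in_clint)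
  then show ?thesis by auto
qed

lemma open_upperE:
  assumes "open G" "upper x \<in> G" "0 \<le> x" "x < 1"
  obtains d where "x < d" "d \<le> 1" "clint x d \<subseteq> G"
proof -
  have "upper x < lower 1" using assms by (simp add: less_da_iff da_pair_lower da_pair_upper)
  from open_right[OF assms(1,2) this] obtain b where b: "upper x < b" "{upper x..<b} \<subseteq> G" by auto
  have "x < pos b" using b(1) assms by (auto simp: less_da_iff da_pair_upper)
  \<comment> \<open>With \<open>d\<close> strictly below \<open>pos b\<close>, even
    \<open>lower d\<close> stays below \<open>b\<close>.\<close>
  then obtain d where d: "x < d" "d < pos b" using dense by blast
  have "clint x d \<subseteq> {upper x..<b}"
    using assms d by (auto simp: clint_def less_da_iff le_da_iff da_pair_upper)
  with b d pos_bounds(2)[of b] that[of d] show ?thesis by fastforce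
qed

lemma open_lowerE:
  assumes "open G" "lower x \<in> G" "0 < x" "x \<le> 1"
  obtains c where "0 \<le> c" "c < x" "clint c x \<subseteq> G"
proof -
  have "upper 0 < lower x" using assms by (simp add: less_da_iff da_pair_lower da_pair_upper)
  from open_left[OF assms(1,2) this] obtain b where b: "b < lower x" "{b<..lower x} \<subseteq> G" by auto
  have "pos b < x" using b(1) assms by (auto simp: less_da_iff da_pair_lower)
  then obtain d where d: "pos b < d" "d < x" using dense by blast
  have "clint d x \<subseteq> {b<..lower x}"
    using assms d by (auto simp: clint_def less_da_iff le_da_iff da_pair_lower)
  with b d pos_bounds(1)[of b] that[of d] show ?thesis by fastforce
qed

lemma open_contains_clint:
  assumes "open G" "G \<noteq> {}"
  obtains c d where "0 \<le> c" "c < d" "d \<le> 1" "clint c d \<subseteq> G"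
proof -
  obtain p where "p \<in> G" using assms by auto
  then show ?thesis
  proof (cases p rule: double_arrow_cases)
    case (lower x)
    with \<open>p \<in> G\<close> assms(1) show ?thesis
      using that[of _ x] open_lowerE by metis
  next
    case (upper x)
    with \<open>p \<in> G\<close> assms(1) show ?thesis
      using that[of x] open_upperE by metis
  qed
qed

text \<open>Two points at different positions are separated by \<open>upper z\<close> for any real
  \<open>z\<close> strictly between them, so the jumps of the order are exactly the twins. This
  describes twins by the order alone.\<close>

lemma adjacent_double_arrow:
  assumes "u < v" "\<And>r. \<not> (u < r \<and> r < v)"
  obtains y where "0 < y" "y < 1" "u = lower y" "v = upper y"
proof -
  have eq: "pos u = pos v"
  proof (rule ccontr)
    assume "pos u \<noteq> pos v"
    with assms(1) have "pos u < pos v" by (auto simp: less_da_iff)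
    then obtain z where z: "pos u < z" "z < pos v" using dense by blast
    then have "0 \<le> z" "z < 1" using pos_bounds[of u] pos_bounds[of v] by auto
    then show False using assms(2)[of "upper z"] z by (auto simp: less_da_iff da_pair_upper)
  qed
  show ?thesis
    using assms(1) eq that
    by (cases u rule: double_arrow_cases; cases v rule: double_arrow_cases)
       (auto simp: less_da_iff da_pair_lower da_pair_upper)
qed

text \<open>The Baire category theorem: were every \<open>T i\<close> nowhere dense in the interval,
  the dense open sets \<open>G i\<close> would share a point there that no \<open>T i\<close>
  covers.\<close>

lemma Baire_interval:
  fixes T :: "'i::countable \<Rightarrow> real set"
  assumes "a < b" "{a<..<b} \<subseteq> (\<Union>i. T i)"
  obtains i c d where "a \<le> c" "c < d" "d \<le> b" "{c<..<d} \<subseteq> closure (T i)"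
proof -
  obtain a' where a': "a < a'" "a' < b" using \<open>a < b\<close> dense by blast
  then obtain b' where b': "a' < b'" "b' < b" using dense by blast
  \<comment> \<open>Cutting down to \<open>{a'..b'}\<close> ensures that a ball inside the
    complement of \<open>G i\<close> lies in the original interval.\<close>
  define G where "G i = - (closure (T i) \<inter> {a'..b'})" for i
  have "\<exists>i. closure (G i) \<noteq> UNIV"
  proof (rule ccontr)
    assume "\<not> ?thesis"
    then have "(UNIV::real set) \<subseteq> closure (\<Inter>(range G))"
      by (intro Baire) (auto simp: G_def open_Compl closed_Int)
    then have "{a'<..<b'} \<inter> closure (\<Inter>(range G)) = {a'<..<b'}" by blast
    then have "{a'<..<b'} \<inter> \<Inter>(range G) \<noteq> {}"
      using open_Int_closure_eq_empty[OF open_greaterThanLessThan, of a' b' "\<Inter>(range G)"] b'(1)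
        greaterThanLessThan_empty_iff[of a' b'] by argo
    then obtain x where "x \<in> {a'<..<b'} \<inter> \<Inter>(range G)" by (meson ex_in_conv)
    then have x: "a' < x" "x < b'" "x \<in> G i" for i by simp_all
    have "x \<in> {a<..<b}" using x(1,2) a' b' by simp
    then obtain i where "x \<in> T i" using assms(2) by blast
    then show False using x(1,2) x(3)[of i] closure_subset[of "T i"] by (auto simp: G_def)
  qed
  then obtain i where i: "interior (closure (T i) \<inter> {a'..b'}) \<noteq> {}"
    by (auto simp: G_def closure_complement)
  then obtain z where "z \<in> interior (closure (T i) \<inter> {a'..b'})" by blast
  then obtain e where e: "e > 0" "ball z e \<subseteq> closure (T i) \<inter> {a'..b'}"
    using mem_interior by metis
  have in1: "{z-e<..<z+e} \<subseteq> closure (T i) \<inter> {a'..b'}"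
    using e by (auto simp: ball_eq_greaterThanLessThan)
  then have "{z - e<..<z+e} \<subseteq> {a'..b'}" by blast
  then have "a' \<le> z - e" "z + e \<le> b'" using e(1)
    by (simp_all add: greaterThanLessThan_subseteq_atLeastAtMost_iff)
  then show ?thesis using that[of "z-e" "z+e" i] in1 e a' b' by auto
qed

subsection \<open>Local monotonicity of homeomorphisms\<close>

text \<open>Every nonempty open set contains some \<open>clint c d\<close>, hence all
  \<open>upper t\<close> with \<open>t\<close> in a real interval. Density of \<open>T\<close> among
  the reals thus passes to its upper copies.\<close>

lemma clint_meets_dense:
  assumes "{a<..<b} \<subseteq> closure T" "open G" "p \<in> G" "p \<in> clint a b" "0 \<le> a" "b \<le> 1"
  obtains t where "t \<in> T" "a < t" "t < b" "upper t \<in> G"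
proof -
  have "open (G \<inter> clint a b)" "G \<inter> clint a b \<noteq> {}"
    using assms open_clint by auto
  then obtain c d where cd: "0 \<le> c" "c < d" "d \<le> 1" "clint c d \<subseteq> G \<inter> clint a b"
    using open_contains_clint by metis
  have "upper c \<in> clint c d" "lower d \<in> clint c d"
    using cd by (simp_all add: upper_in_clint lower_in_clint)
  with cd have ab: "a \<le> c" "d \<le> b"
    using upper_in_clint[of c a b] lower_in_clint[of d a b] by auto
  obtain m where m: "c < m" "m < d" using cd dense by blast
  then have "m \<in> closure T" using assms(1) ab by auto
  then have "{c<..<d} \<inter> T \<noteq> {}"
    using m open_Int_closure_eq_empty[OF open_greaterThanLessThan, of c d T] by auto
  then obtain t where t: "t \<in> T" "c < t" "t < d" by auto
  then have "upper t \<in> clint c d" using cd by (simp add: upper_in_clint)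
  then show ?thesis using that[of t] t ab cd by auto
qed

text \<open>The Boolean selects the order or its reverse. It treats increasing and decreasing maps
  together and can be part of the countable index in the Baire argument.\<close>

definition le_dir :: "bool \<Rightarrow> 'a::linorder \<Rightarrow> 'a \<Rightarrow> bool" where
  "le_dir s u v \<longleftrightarrow> (if s then u \<le> v else v \<le> u)"

text \<open>The order is a closed relation, so its failure at one pair persists for all nearby
  pairs.\<close>

lemma not_le_dir_separate:
  fixes u v :: "'a::linorder_topology"
  assumes "\<not> le_dir s u v"
  obtains G H where "open G" "open H" "u \<in> G" "v \<in> H"
    "\<And>u' v'. u' \<in> G \<Longrightarrow> v' \<in> H \<Longrightarrow> \<not> le_dir s u' v'"
proof -
  have sep: "\<exists>G H. open G \<and> open H \<and> x \<in> G \<and> y \<in> H \<and> (\<forall>x'\<in>G. \<forall>y'\<in>H. x' < y')"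
    if xy: "x < y" for x y :: 'a
  proof -
    obtain a b where "x \<in> {..<a}" "y \<in> {b<..}" "{..<a} \<inter> {b<..} = {}"
      using less_separate[OF xy] by blast
    moreover from this have "x' < y'" if "x' \<in> {..<a}" "y' \<in> {b<..}" for x' y'
      using that by (force simp: not_less[symmetric])
    ultimately show ?thesis by (meson open_lessThan open_greaterThan)
  qed
  show ?thesis
  proof (cases s)
    case True
    with assms have "v < u" by (simp add: le_dir_def)
    from sep[OF this] show ?thesis using that True by (metis le_dir_def not_le)
  next
    case False
    with assms have "u < v" by (simp add: le_dir_def)
    from sep[OF this] show ?thesis using that False by (metis le_dir_def not_le)
  qed
qed

text \<open>At a point \<^term>\<open>upper x\<close> a continuous map is locally bounded by its value there, from
  below if the value lies in the upper arrow and from above otherwise. By Baire, one of the two bounds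
  holds with a uniform radius for a somewhere dense set of \<^term>\<open>x\<close>.\<close>
lemma locally_monotone:
  fixes h :: "double_arrow \<Rightarrow> double_arrow"
  assumes cont: "continuous_on UNIV h" and ab: "0 \<le> a" "a < b" "b \<le> 1"
  obtains s c d where "a \<le> c" "c < d" "d \<le> b"
    "\<And>p q. p \<in> clint c d \<Longrightarrow> q \<in> clint c d \<Longrightarrow> p < q \<Longrightarrow> le_dir s (h p) (h q)"
proof -
  have open_vim: "open (h -` G)" if "open G" for G
    using open_vimage[OF that cont] .
  define T where "T = (\<lambda>(s, n::nat).
    {x. \<forall>p\<in>clint x (x + 1 / Suc n). le_dir s (h (upper x)) (h p)})"
  have "{a<..<b} \<subseteq> (\<Union>i. T i)"
  proof
    fix x assume "x \<in> {a<..<b}"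
    then have x: "0 \<le> x" "x < 1" using ab by auto
    define s where "s = (side (h (upper x)) = 1)"
    define y where "y = pos (h (upper x))"
    define G where "G = (if s then {p. y < pos p \<or> pos p = y \<and> side p = 1}
      else {p. pos p < y \<or> pos p = y \<and> side p = 0})"
    have "open G" 
      using clopen_halfline[of y] unfolding G_def by (simp only: if_split) blast
    have "h (upper x) \<in> G"
      using side_eq[of "h (upper x)"] by (auto simp: G_def s_def y_def)
    then have "upper x \<in> h -` G" by simp
    from open_upperE[OF open_vim[OF \<open>open G\<close>] this x]
    obtain d where d: "x < d" "clint x d \<subseteq> h -` G" by metis
    obtain n where "1 / real (Suc n) < d - x"
      using d(1) nat_approx_posE[of "d - x"] by (metis diff_gt_0_iff_gt)
    then have "clint x (x + 1 / Suc n) \<subseteq> clint x d"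
      by (intro clint_mono) auto
    moreover have "le_dir s (h (upper x)) q" if "q \<in> G" for q
      using that side_eq[of "h (upper x)"]
      by (auto simp: G_def le_dir_def le_da_iff s_def y_def split: if_splits)
    ultimately have "x \<in> T (s, n)" using d(2) by (fastforce simp: T_def)
    then show "x \<in> (\<Union>i. T i)" by blast
  qed
  with \<open>a < b\<close> obtain i c d where cd: "a \<le> c" "c < d" "d \<le> b" "{c<..<d} \<subseteq> closure (T i)"
    by (rule Baire_interval)
  obtain s n where i: "i = (s, n)" by (cases i)
  \<comment> \<open>On an interval of length at most \<open>1 / Suc n\<close>, any two points lie
    within the uniform radius of each other.\<close>
  define d' where "d' = min d (c + 1 / Suc n)"
  have d': "c < d'" "d' \<le> d" "d' \<le> c + 1 / Suc n"
    using cd by (auto simp: d'_def)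
  have dense: "{c<..<d'} \<subseteq> closure (T i)" using cd d' by auto
  \<comment> \<open>A violation at \<open>p < q\<close> is an open condition, so it can be moved to
    \<open>upper t < upper u\<close> with \<open>t\<close> and \<open>u\<close> in
    \<open>T i\<close>, where the uniform bound forbids it.\<close>
  have "le_dir s (h p) (h q)" if pq: "p \<in> clint c d'" "q \<in> clint c d'" "p < q" for p q
  proof (rule ccontr)
    assume "\<not> ?thesis"
    then obtain G H where GH: "open G" "open H" "h p \<in> G" "h q \<in> H"
      "\<And>u v. u \<in> G \<Longrightarrow> v \<in> H \<Longrightarrow> \<not> le_dir s u v"
      by (rule not_le_dir_separate) blast
    \<comment> \<open>Since \<open>le_dir True\<close> is the order itself, the same separation
      keeps the perturbed points in the order of \<open>p\<close> and \<open>q\<close>.\<close>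
    have "\<not> le_dir True q p" using pq by (simp add: le_dir_def)
    then obtain P Q where PQ: "open Q" "open P" "q \<in> Q" "p \<in> P"
      "\<And>q' p'. q' \<in> Q \<Longrightarrow> p' \<in> P \<Longrightarrow> \<not> le_dir True q' p'"
      by (rule not_le_dir_separate) blast
    have bd: "0 \<le> c" "d' \<le> 1" using ab cd d' by auto
    have "open (h -` G \<inter> P)" "p \<in> h -` G \<inter> P" "open (h -` H \<inter> Q)" "q \<in> h -` H \<inter> Q"
      using GH PQ open_vim by auto
    then obtain t u where t: "t \<in> T i" "c < t" "t < d'" "upper t \<in> h -` G \<inter> P"
      and u: "u \<in> T i" "c < u" "u < d'" "upper u \<in> h -` H \<inter> Q"
      using clint_meets_dense[OF dense _ _ _ bd] pq by metis
    have "upper t < upper u" using PQ(5)[of "upper u" "upper t"] t u by (auto simp: le_dir_def)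
    then have "t < u" using t u bd by (auto simp: less_da_iff da_pair_upper)
    moreover have "u < t + 1 / Suc n" using t u d' by linarith
    ultimately have "upper u \<in> clint t (t + 1 / Suc n)"
      using t u bd by (subst upper_in_clint) auto
    then have "le_dir s (h (upper t)) (h (upper u))" using t(1) by (auto simp: T_def i)
    then show False using GH(5) t u by auto
  qed
  with cd d' that[of c d' s] show ?thesis by auto
qed

text \<open>A monotone injection keeps points adjacent if nothing outside its image can slip between
  the values, and adjacent points are twins. If the map is decreasing, the twins are swapped, hence
  the unordered pairs.\<close>

lemma homeomorphism_preserves_twins:
  fixes h g :: "double_arrow \<Rightarrow> double_arrow"
  assumes cont: "continuous_on UNIV h" "continuous_on UNIV g"
    and inv: "\<And>p. g (h p) = p" "\<And>p. h (g p) = p"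
    and "open G" "G \<noteq> {}"
  obtains c d where "0 \<le> c" "c < d" "d \<le> 1" "clint c d \<subseteq> G"
    "\<And>x. c < x \<Longrightarrow> x < d \<Longrightarrow> \<exists>y. 0 < y \<and> y < 1 \<and> {h (lower x), h (upper x)} = {lower y, upper y}"
proof -
  obtain a0 b0 where ab0: "0 \<le> a0" "a0 < b0" "b0 \<le> 1" "clint a0 b0 \<subseteq> G"
    using assms open_contains_clint by metis
  obtain s a b where ab: "a0 \<le> a" "a < b" "b \<le> b0"
    and mono: "\<And>p q. p \<in> clint a b \<Longrightarrow> q \<in> clint a b \<Longrightarrow> p < q \<Longrightarrow> le_dir s (h p) (h q)"
    using locally_monotone[OF cont(1) ab0(1-3)] by metis
  have bd: "0 \<le> a" "b \<le> 1" using ab ab0 by auto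
  \<comment> \<open>Shrink twice: \<open>clint e f\<close> lies in the image of
    \<open>clint a b\<close>, and \<open>h\<close> maps \<open>clint c d\<close> into
    \<open>clint e f\<close>. A point between two values of \<open>h\<close> on
    \<open>clint c d\<close> then has its preimage in \<open>clint a b\<close>, where
    \<open>h\<close> is monotone.\<close>
  have "open (g -` clint a b)" using open_vimage[OF open_clint cont(2)] .
  moreover have "h (upper a) \<in> g -` clint a b"
    using ab bd by (simp add: inv upper_in_clint)
  ultimately obtain e f where ef: "0 \<le> e" "e < f" "f \<le> 1" "clint e f \<subseteq> g -` clint a b"
    using open_contains_clint by (metis empty_iff)
  have "open (h -` clint e f)" using open_vimage[OF open_clint cont(1)] .
  moreover have "g (upper e) \<in> h -` clint e f"
    using ef by (simp add: inv upper_in_clint)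
  ultimately obtain c d where cd: "0 \<le> c" "c < d" "d \<le> 1" "clint c d \<subseteq> h -` clint e f"
    using open_contains_clint by (metis empty_iff)
  have sub: "clint c d \<subseteq> clint a b"
    using cd(4) ef(4) inv by (metis subsetI subsetD vimageE vimageI2)
  have "\<exists>y. 0 < y \<and> y < 1 \<and> {h (lower x), h (upper x)} = {lower y, upper y}" if x: "c < x" "x < d" for x
  proof -
    have x01: "0 < x" "x < 1" using x cd by auto
    have lu: "lower x \<in> clint c d" "upper x \<in> clint c d" "lower x < upper x"
      using x x01 by (simp_all add: lower_in_clint upper_in_clint less_da_iff da_pair_lower da_pair_upper)
    then have le: "le_dir s (h (lower x)) (h (upper x))" using mono sub by blast
    have ne: "h (lower x) \<noteq> h (upper x)" using lu(3) by (metis inv(1) less_irrefl)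
    have gap: False
      if r: "h (lower x) < r \<and> r < h (upper x) \<or> h (upper x) < r \<and> r < h (lower x)" for r
    proof -
      have "h (lower x) \<in> clint e f" "h (upper x) \<in> clint e f"
        using subsetD[OF cd(4) lu(1)] subsetD[OF cd(4) lu(2)] by simp_all
      with r have "r \<in> clint e f" using clint_convex by metis
      then have gr: "g r \<in> clint a b" using ef(4) by blast
      have "g r \<noteq> lower x" "g r \<noteq> upper x" using r inv(2)[of r] by auto
      moreover have "g r \<le> lower x \<or> upper x \<le> g r"
        using x01 side_eq[of "g r"] by (auto simp: le_da_iff da_pair_lower da_pair_upper)
      ultimately have "g r < lower x \<or> upper x < g r" by auto
      then have "le_dir s r (h (lower x)) \<or> le_dir s (h (upper x)) r"
        using mono gr lu sub inv(2) by (metis subsetD)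
      with r le show False by (auto simp: le_dir_def split: if_splits)
    qed
    consider "h (lower x) < h (upper x)" | "h (upper x) < h (lower x)" using ne by fastforce
    then show ?thesis
    proof cases
      case 1
      have gap': "\<not> (h (lower x) < r \<and> r < h (upper x))" for r using gap[of r] by blast
      obtain y where "0 < y" "y < 1" "h (lower x) = lower y" "h (upper x) = upper y"
        by (rule adjacent_double_arrow[OF 1 gap'])
      then show ?thesis by (intro exI[of _ y]) simp
    next
      case 2
      have gap': "\<not> (h (upper x) < r \<and> r < h (lower x))" for r using gap[of r] by blast
      obtain y where "0 < y" "y < 1" "h (upper x) = lower y" "h (lower x) = upper y"
        by (rule adjacent_double_arrow[OF 2 gap'])
      then show ?thesis by (intro exI[of _ y]) (simp add: insert_commute)
    qed
  qed
  moreover have "clint c d \<subseteq> G"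
  proof -
    have "clint a b \<subseteq> clint a0 b0" using ab by (intro clint_mono)
    then show ?thesis using sub ab0 by auto
  qed
  ultimately show ?thesis using cd that by auto
qed

subsection \<open>Boundaries with points of every finite Cantor-Bendixson rank\<close>

text \<open>Limit points are taken in the whole space. For closed \<open>F\<close> they stay in
  \<open>F\<close>, and the sequence is the usual decreasing one of Cantor-Bendixson
  derivatives.\<close>

primrec cb_derivative :: "nat \<Rightarrow> 'a::topological_space set \<Rightarrow> 'a set" where
  "cb_derivative 0 F = F"
| "cb_derivative (Suc n) F = {p. p islimpt cb_derivative n F}"

text \<open>Openness of \<open>W\<close> makes being a limit point a local matter, and closedness
  keeps limit points of subsets inside \<open>W\<close>. Ranks can therefore be computed in each
  clopen piece separately.\<close>

lemma cb_derivative_Int_clopen: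
  assumes "open W" "closed W"
  shows "cb_derivative n (F \<inter> W) = cb_derivative n F \<inter> W"
proof (induction n)
  case (Suc n)
  have "p islimpt (X \<inter> W) \<longleftrightarrow> p islimpt X \<and> p \<in> W" for p X
  proof
    assume "p islimpt (X \<inter> W)"
    then show "p islimpt X \<and> p \<in> W"
      using assms(2) by (metis closed_limpt inf_le1 inf_le2 islimpt_subset)
  next
    assume "p islimpt X \<and> p \<in> W"
    then show "p islimpt (X \<inter> W)"
      using assms(1) unfolding islimpt_def by (metis IntE IntI open_Int)
  qed
  then show ?case using Suc by auto
qed simp

lemma cb_derivative_antimono:
  assumes "closed F" "m \<le> n"
  shows "cb_derivative n F \<subseteq> cb_derivative m F"
proof (rule lift_Suc_antimono_le[OF _ assms(2)])
  fix k show "cb_derivative (Suc k) F \<subseteq> cb_derivative k F"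
  proof (induction k)
    case 0
    then show ?case using assms(1) by (auto simp: closed_limpt)
  next
    case (Suc k)
    then show ?case by (auto intro: islimpt_subset)
  qed
qed

lemma cb_derivative_subset: "closed F \<Longrightarrow> cb_derivative n F \<subseteq> F"
  using cb_derivative_antimono[of F 0 n] by simp

lemma homeomorphism_image_cb_derivative:
  fixes h g :: "'a::topological_space \<Rightarrow> 'a"
  assumes cont: "continuous_on UNIV h" "continuous_on UNIV g"
    and inv: "\<And>p. g (h p) = p" "\<And>p. h (g p) = p"
  shows "h ` cb_derivative n F = cb_derivative n (h ` F)"
proof (induction n)
  case (Suc n)
  have image_lim: "f p islimpt f ` X" if lim: "p islimpt X" and f: "continuous_on UNIV f" "inj f" for f :: "'a \<Rightarrow> 'a" and p X
    unfolding islimpt_def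
  proof (intro allI impI)
    fix T assume "f p \<in> T" "open T"
    then have "p \<in> f -` T" "open (f -` T)" using open_vimage[OF _ f(1)] by auto
    then obtain y where "y \<in> X" "y \<in> f -` T" "y \<noteq> p"
      using lim unfolding islimpt_def by metis
    then show "\<exists>y\<in>f ` X. y \<in> T \<and> y \<noteq> f p" using \<open>inj f\<close> by (auto simp: inj_eq)
  qed
  have inj: "inj h" "inj g" using inv by (metis injI)+
  have gh: "g ` h ` X = X" for X using inv by (force simp: image_iff)
  have "p islimpt X \<longleftrightarrow> h p islimpt h ` X" for p X
    using image_lim[of p X h] image_lim[of "h p" "h ` X" g] cont inj gh inv by auto
  then have "h ` {p. p islimpt X} = {p. p islimpt h ` X}" for X
    using inv by (auto simp: image_iff) metis
  then show ?case using Suc by simp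
qed simp

section \<open>Clopen cells accumulating at the left end of an interval\<close>

definition node :: "real \<Rightarrow> real \<Rightarrow> nat \<Rightarrow> real" where
  "node a b k = a + (b - a) / 2 ^ k"

text \<open>Neighbouring cells share a real endpoint but no point: the cell on the left takes its
  lower copy, the cell on the right its upper copy.\<close>

definition cell :: "real \<Rightarrow> real \<Rightarrow> nat \<Rightarrow> double_arrow set" where
  "cell a b k = clint (node a b (Suc k)) (node a b k)"

lemma open_cell: "open (cell a b k)" and closed_cell: "closed (cell a b k)"
  by (simp_all add: cell_def open_clint closed_clint)

context
  fixes a b :: real
  assumes ab: "0 \<le> a" "a < b" "b \<le> 1"
begin

lemma node_bounds: "a < node a b k" "node a b k \<le> b"
proof -
  have "(b - a) / 2 ^ k \<le> (b - a) / 1"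
    using ab by (intro divide_left_mono) auto
  then show "a < node a b k" "node a b k \<le> b" using ab by (simp_all add: node_def)
qed

lemma node_less: "node a b (Suc k) < node a b k"
  unfolding node_def
  by (intro add_strict_left_mono divide_strict_left_mono) (use ab in simp_all)

lemma node_antimono: "k \<le> l \<Longrightarrow> node a b l \<le> node a b k"
  by (rule lift_Suc_antimono_le[of "node a b", OF less_imp_le[OF node_less]])

lemma node_small:
  assumes "a < x"
  obtains k where "node a b k < x"
proof -
  have "0 < (x - a) / (b - a)" using assms ab by simp
  from real_arch_pow_inv[OF this, of "1 / 2"]
  obtain k where "(1 / 2) ^ k < (x - a) / (b - a)" by auto
  then have "(b - a) * (1 / 2) ^ k < x - a"
    using ab by (simp add: pos_less_divide_eq mult.commute)
  then have "node a b k < x" by (simp add: node_def power_divide)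
  then show ?thesis by (rule that)
qed

lemma upper_notin_cell: "upper a \<notin> cell a b k"
  using ab node_bounds(1)[of "Suc k"] by (simp add: cell_def upper_in_clint)

lemma cell_subset: "cell a b k \<subseteq> clint a b"
  unfolding cell_def using node_bounds(1)[of "Suc k"] node_bounds(2)[of k] by (intro clint_mono) auto

lemma disjoint_cells: "k \<noteq> l \<Longrightarrow> cell a b k \<inter> cell a b l = {}"
proof (induction k l rule: linorder_wlog)
  case (le k l)
  then have "node a b l \<le> node a b (Suc k)" by (intro node_antimono) auto
  then show ?case by (auto simp: cell_def clint_def)
qed (simp add: Int_commute)

lemma clint_eq_cells: "clint a b = insert (upper a) (\<Union>k. cell a b k)"
proof (intro equalityI subsetI)
  fix p assume p: "p \<in> clint a b"
  \<comment> \<open>\<open>R c\<close> says that \<open>p\<close> lies to the right of the cut at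
    \<open>c\<close>. The cell of \<open>p\<close> is found at the first node whose cut lies to the
    left of \<open>p\<close>.\<close>
  define R where "R c \<longleftrightarrow> c < pos p \<or> pos p = c \<and> side p = 1" for c
  have cl: "p \<in> clint c d \<longleftrightarrow> R c \<and> \<not> R d" for c d
    using side_eq[of p] by (auto simp: clint_def R_def)
  show "p \<in> insert (upper a) (\<Union>k. cell a b k)"
  proof (cases "p = upper a")
    case False
    then have "a < pos p" using p ab by (auto simp: clint_def da_eq_iff da_pair_upper)
    then obtain k0 where "node a b k0 < pos p" by (rule node_small)
    then have ex: "R (node a b k0)" by (simp add: R_def)
    have "\<not> R (node a b 0)" using p cl by (simp add: node_def)
    from ex_least_nat_less[of "\<lambda>k. R (node a b k)", OF ex this]
    obtain k where "\<not> R (node a b k)" "R (node a b (Suc k))" by auto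
    then have "p \<in> cell a b k" using cl by (simp add: cell_def)
    then show ?thesis by blast
  qed simp
next
  fix p assume "p \<in> insert (upper a) (\<Union>k. cell a b k)"
  then show "p \<in> clint a b" using cell_subset ab by (auto simp: upper_in_clint)
qed

lemma cells_converge:
  assumes "open G" "upper a \<in> G"
  obtains N where "\<And>k. N \<le> k \<Longrightarrow> cell a b k \<subseteq> G"
proof -
  obtain d where d: "a < d" "clint a d \<subseteq> G"
    using ab by (metis open_upperE[OF assms] order_less_le_trans)
  obtain N where N: "node a b N < d" using d(1) by (rule node_small)
  have "cell a b k \<subseteq> G" if "N \<le> k" for k
  proof -
    have "cell a b k \<subseteq> clint a d"
      unfolding cell_def using node_bounds(1)[of "Suc k"] node_antimono[OF that] N
      by (intro clint_mono) auto
    with d show ?thesis by auto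
  qed
  then show ?thesis by (rule that)
qed

text \<open>Late cells lie in any given neighbourhood of \<open>upper a\<close>, and no cell
  contains \<open>upper a\<close> itself.\<close>

lemma upper_islimptI:
  assumes "\<And>N. \<exists>k\<ge>N. X \<inter> cell a b k \<noteq> {}"
  shows "upper a islimpt X"
  unfolding islimpt_def
proof (intro allI impI)
  fix G assume "upper a \<in> G" "open G"
  then obtain N where "\<And>k. N \<le> k \<Longrightarrow> cell a b k \<subseteq> G" using cells_converge by metis
  then show "\<exists>y\<in>X. y \<in> G \<and> y \<noteq> upper a" using assms[of N] upper_notin_cell by blast
qed

end

text \<open>Equality with \<open>W\<close>, not just covering, keeps both parts inside
  \<open>W\<close>, so that splittings of disjoint cells can be glued. The set of interest is the
  common boundary \<open>closure U \<inter> closure V\<close>.\<close>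

definition splits :: "'a::topological_space set \<Rightarrow> 'a set \<Rightarrow> 'a set \<Rightarrow> bool" where
  "splits W U V \<longleftrightarrow> open U \<and> open V \<and> U \<inter> V = {} \<and> closure U \<union> closure V = W"

text \<open>Cells are clopen and disjoint, so within a cell the glued sets have the same closures as
  their pieces. Only \<open>upper a\<close> lies outside all cells; it is the one possible new
  boundary point, and it is covered because the cells accumulate there.\<close>

lemma splits_UN_cells:
  assumes ab: "0 \<le> a" "a < b" "b \<le> 1"
    and sp: "\<And>k. splits (cell a b k) (U k) (V k)"
  defines "F \<equiv> closure (\<Union>k. U k) \<inter> closure (\<Union>k. V k)"
  shows "splits (clint a b) (\<Union>k. U k) (\<Union>k. V k)"
    and "F \<inter> cell a b k = closure (U k) \<inter> closure (V k)"
    and "F \<subseteq> insert (upper a) (\<Union>k. closure (U k) \<inter> closure (V k))"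
proof -
  have sub: "closure (U k) \<subseteq> cell a b k" "closure (V k) \<subseteq> cell a b k" for k
    using sp[of k] by (auto simp: splits_def)
  have sub': "U k \<subseteq> cell a b k" "V k \<subseteq> cell a b k" for k
    using sub[of k] closure_subset by blast+
  have cl: "closure (\<Union>k. X k) \<inter> cell a b k = closure (X k)"
    if X: "\<And>k. X k \<subseteq> cell a b k" for X k
  proof
    have "X l \<inter> cell a b k \<subseteq> X k" for l
      using X[of l] disjoint_cells[OF ab, of l k] by (cases "l = k") blast+
    then have "cell a b k \<inter> (\<Union>k. X k) \<subseteq> X k" by blast
    from closure_mono[OF this] show "closure (\<Union>k. X k) \<inter> cell a b k \<subseteq> closure (X k)"
      using open_Int_closure_subset[OF open_cell, of a b k "\<Union>k. X k"] by blast
    show "closure (X k) \<subseteq> closure (\<Union>k. X k) \<inter> cell a b k"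
      using closure_minimal[OF X closed_cell] closure_mono[of "X k" "\<Union>k. X k"] by blast
  qed
  show F: "F \<inter> cell a b k = closure (U k) \<inter> closure (V k)" for k
    unfolding F_def using cl[OF sub'(1), of k] cl[OF sub'(2), of k] by blast
  have clsub: "closure (\<Union>k. X k) \<subseteq> clint a b" if "\<And>k. X k \<subseteq> cell a b k" for X
    using that cell_subset[OF ab] by (intro closure_minimal closed_clint) blast
  have "F \<subseteq> clint a b" unfolding F_def using clsub[OF sub'(1)] by blast
  then have "F \<subseteq> insert (upper a) (\<Union>k. cell a b k)"
    by (simp only: clint_eq_cells[OF ab])
  then show "F \<subseteq> insert (upper a) (\<Union>k. closure (U k) \<inter> closure (V k))"
    unfolding F[symmetric] Int_UN_distrib[symmetric]
    by (intro subsetI) (metis IntI insertCI insertE subsetD)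
  have disj: "U k \<inter> V l = {}" for k l
    using sp[of k] sub'(1)[of k] sub'(2)[of l] disjoint_cells[OF ab, of k l]
    by (cases "k = l") (auto simp: splits_def)
  let ?C = "closure (\<Union>k. U k) \<union> closure (\<Union>k. V k)"
  have cells: "cell a b k \<subseteq> ?C" for k
    using sp[of k] cl[OF sub'(1), of k] cl[OF sub'(2), of k] unfolding splits_def by blast
  have "cell a b k \<noteq> {}" for k
  proof -
    have "upper (node a b (Suc k)) \<in> cell a b k"
      using node_bounds[OF ab, of "Suc k"] node_bounds[OF ab, of k] node_less[OF ab, of k] ab
      by (auto simp: cell_def upper_in_clint)
    then show ?thesis by blast
  qed
  then have "upper a islimpt ?C"
    using cells by (intro upper_islimptI[OF ab]) blast
  then have "upper a \<in> ?C"
    by (metis closed_Un closed_closure closed_limpt)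
  then have "clint a b \<subseteq> ?C"
    unfolding clint_eq_cells[OF ab] using cells by (intro insert_subset[THEN iffD2] conjI UN_least)
  moreover have "?C \<subseteq> clint a b" using clsub[OF sub'(1)] clsub[OF sub'(2)] by blast
  moreover have "(\<Union>k. U k) \<inter> (\<Union>k. V k) = {}" using disj by blast
  ultimately show "splits (clint a b) (\<Union>k. U k) (\<Union>k. V k)"
    using sp unfolding splits_def by blast
qed

lemma node_bounds_01:
  assumes "0 \<le> a" "a < b" "b \<le> 1"
  shows "0 \<le> node a b (Suc k)" "node a b (Suc k) < node a b k" "node a b k \<le> 1"
  using node_bounds[OF assms, of k] node_bounds[OF assms, of "Suc k"] node_less[OF assms, of k] assms
  by auto

text \<open>By induction, with all intervals at once since the hypothesis is applied in every cell.
  The last points of rank \<open>n\<close> in the cells converge to \<open>upper a\<close>, which is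
  then the only point of the next derivative.\<close>

lemma splits_with_rank:
  assumes "0 \<le> a" "a < b" "b \<le> 1"
  shows "\<exists>U V p. splits (clint a b) U V \<and> cb_derivative n (closure U \<inter> closure V) = {p}"
  using assms
proof (induction n arbitrary: a b)
  case 0
  note ab = this
  \<comment> \<open>Alternating whole cells creates no boundary inside a cell, while both parts
    accumulate at \<open>upper a\<close>.\<close>
  define U where "U k = (if even k then cell a b k else {})" for k
  define V where "V k = (if even k then {} else cell a b k)" for k
  have sp: "splits (cell a b k) (U k) (V k)" for k
    by (simp add: splits_def U_def V_def open_cell closed_cell)
  have mem: "upper (node a b (Suc k)) \<in> cell a b k" for k
    using node_bounds_01[OF ab, of k] by (auto simp: cell_def upper_in_clint)
  have "upper a islimpt (\<Union>k. U k)"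
  proof (rule upper_islimptI[OF ab])
    show "\<exists>k\<ge>N. (\<Union>k. U k) \<inter> cell a b k \<noteq> {}" for N
    proof -
      have "upper (node a b (Suc (2 * N))) \<in> U (2 * N)" using mem by (simp add: U_def)
      then show ?thesis using mem[of "2 * N"] by (intro exI[of _ "2 * N"]) auto
    qed
  qed
  moreover have "upper a islimpt (\<Union>k. V k)"
  proof (rule upper_islimptI[OF ab])
    show "\<exists>k\<ge>N. (\<Union>k. V k) \<inter> cell a b k \<noteq> {}" for N
    proof -
      have "upper (node a b (Suc (2 * N + 1))) \<in> V (2 * N + 1)" using mem by (simp add: V_def)
      then show ?thesis using mem[of "2 * N + 1"] by (intro exI[of _ "2 * N + 1"]) auto
    qed
  qed
  moreover have "closure (U k) \<inter> closure (V k) = {}" for k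
    by (simp add: U_def V_def)
  ultimately have "closure (\<Union>k. U k) \<inter> closure (\<Union>k. V k) = {upper a}"
    using splits_UN_cells(3)[OF ab, of U V, OF sp] by (auto simp: closure_def)
  then show ?case using splits_UN_cells(1)[OF ab, of U V, OF sp] by auto
next
  case (Suc n)
  note ab = Suc.prems
  have "\<exists>U V p. splits (cell a b k) U V \<and> cb_derivative n (closure U \<inter> closure V) = {p}" for k
    unfolding cell_def using Suc.IH[OF node_bounds_01[OF ab]] .
  then obtain U V p where sp: "\<And>k. splits (cell a b k) (U k) (V k)"
    and p: "\<And>k. cb_derivative n (closure (U k) \<inter> closure (V k)) = {p k}"
    by metis
  define F where "F = closure (\<Union>k. U k) \<inter> closure (\<Union>k. V k)"
  have sp': "splits (clint a b) (\<Union>k. U k) (\<Union>k. V k)"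
    using splits_UN_cells(1)[OF ab, of U V, OF sp] .
  have cell: "cb_derivative m F \<inter> cell a b k = cb_derivative m (closure (U k) \<inter> closure (V k))" for m k
    using splits_UN_cells(2)[OF ab, of U V, OF sp] cb_derivative_Int_clopen[OF open_cell closed_cell]
    unfolding F_def by metis
  have "upper a islimpt cb_derivative n F"
    using cell p by (intro upper_islimptI[OF ab]) (metis insert_not_empty order_refl)
  \<comment> \<open>Inside a cell the derivative of order \<open>n\<close> is a single point, which
    has no limit points.\<close>
  moreover have "cb_derivative (Suc n) F \<inter> cell a b k = {}" for k
    unfolding cell using p[of k] by (simp add: islimpt_finite)
  moreover have "cb_derivative (Suc n) F \<subseteq> insert (upper a) (\<Union>k. cell a b k)"
  proof -
    have "closed F" by (simp add: F_def closed_Int)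
    then have "cb_derivative (Suc n) F \<subseteq> F" by (rule cb_derivative_subset)
    also have "F \<subseteq> clint a b" using sp' by (auto simp: splits_def F_def)
    finally show ?thesis using clint_eq_cells[OF ab] by simp
  qed
  ultimately have "x \<in> cb_derivative (Suc n) F \<longleftrightarrow> x = upper a" for x
    unfolding cb_derivative.simps mem_Collect_eq
    by (metis (no_types, lifting) Int_iff UN_E empty_iff insertE mem_Collect_eq subsetD)
  then have "cb_derivative (Suc n) F = {upper a}" by blast
  then show ?case using sp' unfolding F_def by blast
qed

text \<open>Cell \<open>k\<close> of the whole space receives a splitting with final rank
  \<open>k\<close>. As cells are clopen, the other cells do not change that rank.\<close>

lemma splits_with_all_ranks:
  "\<exists>(U :: double_arrow set) V p. splits UNIV U V \<and>
     (\<forall>n. p n \<in> cb_derivative n (closure U \<inter> closure V) \<and>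
          p n \<notin> cb_derivative (Suc n) (closure U \<inter> closure V))"
proof -
  have ab: "(0::real) \<le> 0" "(0::real) < 1" "(1::real) \<le> 1" by simp_all
  have "\<exists>U V p. splits (cell 0 1 k) U V \<and> cb_derivative k (closure U \<inter> closure V) = {p}" for k
    unfolding cell_def using splits_with_rank[OF node_bounds_01[OF ab]] .
  then obtain U V p where sp: "\<And>k. splits (cell 0 1 k) (U k) (V k)"
    and p: "\<And>k. cb_derivative k (closure (U k) \<inter> closure (V k)) = {p k}"
    by metis
  define F where "F = closure (\<Union>k. U k) \<inter> closure (\<Union>k. V k)"
  have cell: "cb_derivative m F \<inter> cell 0 1 k = cb_derivative m (closure (U k) \<inter> closure (V k))" for m k
    using splits_UN_cells(2)[OF ab, of U V, OF sp] cb_derivative_Int_clopen[OF open_cell closed_cell]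
    unfolding F_def by metis
  have 1: "p n \<in> cb_derivative n F \<inter> cell 0 1 n" for n
    unfolding cell p by simp
  have "cb_derivative (Suc n) F \<inter> cell 0 1 n = {}" for n
    unfolding cell using p[of n] by (simp add: islimpt_finite)
  with 1 have "p n \<notin> cb_derivative (Suc n) F" for n by blast
  with 1 show ?thesis
    using splits_UN_cells(1)[OF ab, of U V, OF sp] unfolding F_def clint_UNIV by blast
qed

subsection \<open>Counting the types\<close>

text \<open>The rationals are taken strictly between 0 and 1, where both copies exist.\<close>

definition coded_set :: "double_arrow set \<Rightarrow> double_arrow set \<Rightarrow> (nat \<Rightarrow> double_arrow) \<Rightarrow> nat set \<Rightarrow> double_arrow set" where
  "coded_set U V p S =
     U \<inter> (lower ` (\<rat> \<inter> {0<..<1}) \<union> upper ` (\<rat> \<inter> {0<..<1})) \<union> V \<inter> upper ` (\<rat> \<inter> {0<..<1}) \<union> p ` S"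

lemma countable_coded_set: "countable (coded_set U V p S)"
  unfolding coded_set_def
  by (intro countable_Un countable_Int2 countable_image countable_Int1 countable_rat countableI_type)

text \<open>The upper copies of rationals are dense in every open set, and the code contains those
  in \<open>U\<close> and in \<open>V\<close>, whose closures fill the space.\<close>

lemma coded_set_dense:
  assumes "splits UNIV U V"
  shows "closure (coded_set U V p S) = UNIV"
proof -
  let ?Q = "upper ` (\<rat> \<inter> {0<..<1})"
  have sub: "G \<subseteq> closure (G \<inter> ?Q)" if G: "open G" for G
  proof
    fix x assume x: "x \<in> G"
    have "G' \<inter> (G \<inter> ?Q) \<noteq> {}" if G': "x \<in> G'" "open G'" for G'
    proof -
      have "open (G \<inter> G')" "G \<inter> G' \<noteq> {}" using G G' x by auto
      then obtain c d where cd: "0 \<le> c" "c < d" "d \<le> 1" "clint c d \<subseteq> G \<inter> G'"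
        using open_contains_clint by metis
      obtain r where r: "r \<in> \<rat>" "c < r" "r < d" using Rats_dense_in_real cd(2) by blast
      then have "upper r \<in> clint c d" "r \<in> \<rat> \<inter> {0<..<1}" using cd by (simp_all add: upper_in_clint)
      with cd(4) show ?thesis by blast
    qed
    then show "x \<in> closure (G \<inter> ?Q)" unfolding closure_iff_nhds_not_empty by blast
  qed
  have "G \<inter> ?Q \<subseteq> coded_set U V p S" if "G = U \<or> G = V" for G
    using that unfolding coded_set_def by blast
  then have "G \<subseteq> closure (coded_set U V p S)" if "G = U \<or> G = V" for G
    using that assms sub[of G] closure_mono[of "G \<inter> ?Q" "coded_set U V p S"]
    unfolding splits_def by blast
  then have "closure U \<union> closure V \<subseteq> closure (coded_set U V p S)"
    using closure_minimal[OF _ closed_closure] by (metis Un_least)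
  with assms show ?thesis by (auto simp: splits_def)
qed

section \<open>Recovering a set of naturals from the type of its code\<close>

locale double_arrow_coding =
  fixes U V :: "double_arrow set" and p :: "nat \<Rightarrow> double_arrow"
  assumes splits: "splits UNIV U V"
    and rank_ge: "p n \<in> cb_derivative n (closure U \<inter> closure V)"
    and rank_le: "p n \<notin> cb_derivative (Suc n) (closure U \<inter> closure V)"
begin

abbreviation "code \<equiv> coded_set U V p"

lemma open_parts: "open U" "open V" "U \<inter> V = {}" "closure U \<union> closure V = UNIV"
  using splits by (auto simp: splits_def)

lemma part_disjoint_boundary: "U \<inter> closure V = {}" "V \<inter> closure U = {}"
  using open_parts open_Int_closure_eq_empty[of U V] open_Int_closure_eq_empty[of V U] by auto

lemma p_boundary: "p n \<in> closure U \<inter> closure V"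
  using rank_ge[of n] cb_derivative_subset[of "closure U \<inter> closure V" n] by (auto simp: closed_Int)

lemma p_notin: "p n \<notin> U" "p n \<notin> V"
  using p_boundary part_disjoint_boundary by blast+

text \<open>The open parts miss the common boundary, so only the added points \<open>p n\<close> can
  lie on it.\<close>

lemma code_boundary: "code S \<inter> (closure U \<inter> closure V) = p ` S"
proof
  show "code S \<inter> (closure U \<inter> closure V) \<subseteq> p ` S"
    using part_disjoint_boundary unfolding coded_set_def by blast
  show "p ` S \<subseteq> code S \<inter> (closure U \<inter> closure V)"
    using p_boundary unfolding coded_set_def by blast
qed

text \<open>Densely many twins inside \<^term>\<open>U\<close> have both members in \<^term>\<open>code S\<close>, but no twins
  inside \<^term>\<open>V\<close> do.\<close>
lemma image_U_avoids_V:
  assumes cont: "continuous_on UNIV h" "continuous_on UNIV g"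
    and inv: "\<And>q. g (h q) = q" "\<And>q. h (g q) = q"
    and img: "h ` code S = code S'"
  shows "h ` U \<inter> V = {}"
proof (rule ccontr)
  assume "h ` U \<inter> V \<noteq> {}"
  then have ne: "U \<inter> h -` V \<noteq> {}" by blast
  have op: "open (U \<inter> h -` V)"
    using open_parts open_vimage[OF _ cont(1)] by blast
  obtain c d where cd: "0 \<le> c" "c < d" "d \<le> 1" "clint c d \<subseteq> U \<inter> h -` V"
    and twins: "\<And>x. c < x \<Longrightarrow> x < d \<Longrightarrow> \<exists>y. 0 < y \<and> y < 1 \<and> {h (lower x), h (upper x)} = {lower y, upper y}"
    using homeomorphism_preserves_twins[OF cont inv op ne] by metis
  obtain r where r: "r \<in> \<rat>" "c < r" "r < d" using Rats_dense_in_real cd(2) by blast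
  have r01: "0 < r" "r < 1" using r cd by auto
  then have "lower r \<in> clint c d" "upper r \<in> clint c d"
    using r by (simp_all add: lower_in_clint upper_in_clint)
  then have UV: "lower r \<in> U" "upper r \<in> U" "h (lower r) \<in> V" "h (upper r) \<in> V"
    using cd(4) by blast+
  have "r \<in> \<rat> \<inter> {0<..<1}" using r r01 by simp
  with UV have "lower r \<in> code S" "upper r \<in> code S" unfolding coded_set_def by blast+
  then have S': "h (lower r) \<in> code S'" "h (upper r) \<in> code S'" using img by blast+
  obtain y where y: "0 < y" "y < 1" "{h (lower r), h (upper r)} = {lower y, upper y}"
    using twins r by blast
  \<comment> \<open>Whichever way the twins are mapped, one image is a lower point of the code
    inside \<open>V\<close>, where the code has only upper points.\<close>
  then have "lower y \<in> V" "lower y \<in> code S'" using UV S' by (metis doubleton_eq_iff)+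
  moreover from this have "lower y \<notin> U" "lower y \<notin> p ` S'"
    using open_parts(3) p_notin(2) by (blast, metis imageE)
  ultimately have "lower y \<in> upper ` (\<rat> \<inter> {0<..<1})"
    unfolding coded_set_def by blast
  then obtain z where "lower y = upper z" "0 < z" "z < 1" by auto
  then show False using y by (metis da_pair_lower da_pair_upper less_imp_le snd_conv zero_neq_one)
qed

text \<open>The image of \<open>U\<close> is open and misses \<open>V\<close>, so it misses
  \<open>closure V\<close> and lies in \<open>closure U\<close>; continuity extends this to the
  closure.\<close>

lemma image_closure_parts:
  assumes cont: "continuous_on UNIV h" "continuous_on UNIV g"
    and inv: "\<And>q. g (h q) = q" "\<And>q. h (g q) = q"
    and img: "h ` code S = code S'"
  shows "h ` closure U \<subseteq> closure U" "h ` closure V \<subseteq> closure V"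
proof -
  have hU: "h ` U \<inter> V = {}" using image_U_avoids_V[OF cont inv img] .
  have "g ` code S' = code S" unfolding img[symmetric] image_image inv by simp
  \<comment> \<open>The same lemma for the inverse \<open>g\<close> yields the statement about
    \<open>V\<close>: \<open>g\<close> sends no point of \<open>U\<close> into \<open>V\<close>
    exactly when \<open>h\<close> sends no point of \<open>V\<close> into \<open>U\<close>.\<close>
  then have gU: "g ` U \<inter> V = {}" by (rule image_U_avoids_V[OF cont(2,1) inv(2,1)])
  have hV: "h ` V \<inter> U = {}"
  proof (rule ccontr)
    assume "h ` V \<inter> U \<noteq> {}"
    then obtain v where "v \<in> V" "h v \<in> U" by blast
    then have "g (h v) \<in> g ` U \<inter> V" by (metis IntI imageI inv(1))
    then show False using gU by blast
  qed
  have "h ` G = g -` G" for G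
    by (intro set_eqI) (metis imageE imageI inv vimageE vimageI)
  then have "open (h ` U)" "open (h ` V)"
    using open_vimage[OF open_parts(1) cont(2)] open_vimage[OF open_parts(2) cont(2)] by simp_all
  then have "h ` U \<inter> closure V = {}" "h ` V \<inter> closure U = {}"
    using open_Int_closure_eq_empty hU hV by blast+
  then have "h ` U \<subseteq> closure U" "h ` V \<subseteq> closure V"
    using open_parts(4) by blast+
  then show "h ` closure U \<subseteq> closure U" "h ` closure V \<subseteq> closure V"
    by (metis image_closure_subset continuous_on_subset[OF cont(1)] closed_closure subset_UNIV)+
qed

text \<open>The homeomorphism preserves the common boundary and all its derivatives, so it takes
  \<open>p n\<close> to a coded boundary point of the same rank, which can only be
  \<open>p n\<close>. One inclusion suffices, as the roles of \<open>S\<close> and \<open>S'\<close>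
  can be exchanged.\<close>

lemma code_determined:
  assumes cont: "continuous_on UNIV h" "continuous_on UNIV g"
    and inv: "\<And>q. g (h q) = q" "\<And>q. h (g q) = q"
    and img: "h ` code S = code S'"
  shows "S \<subseteq> S'"
proof
  fix n assume "n \<in> S"
  define F where "F = closure U \<inter> closure V"
  have img': "g ` code S' = code S" unfolding img[symmetric] image_image inv by simp
  have "h ` F \<subseteq> F" "g ` F \<subseteq> F"
    unfolding F_def using image_closure_parts[OF cont inv img]
      image_closure_parts[OF cont(2,1) inv(2,1) img'] by blast+
  then have hF: "h ` F = F" using inv(2) by (metis image_subset_iff subsetI subset_antisym image_eqI)
  have inj: "inj h" using inv(1) by (metis injI)
  have ranks: "h ` cb_derivative m F = cb_derivative m F" for m
    using homeomorphism_image_cb_derivative[OF cont inv, of m F] hF by simp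
  have "h (p n) \<in> cb_derivative n F" using ranks[of n] rank_ge[of n] by (auto simp: F_def)
  have "h (p n) \<notin> cb_derivative (Suc n) F"
    using ranks[of "Suc n"] rank_le[of n] inj unfolding F_def by (metis inj_image_mem_iff)
  have "p n \<in> code S \<inter> F" using code_boundary \<open>n \<in> S\<close> unfolding F_def by blast
  then have "h (p n) \<in> code S' \<inter> F" using img hF by blast
  then obtain m where m: "m \<in> S'" "h (p n) = p m" using code_boundary unfolding F_def by blast
  have "closed F" by (simp add: F_def closed_Int)
  note antimono = cb_derivative_antimono[OF this]
  \<comment> \<open>If \<open>m < n\<close>, the point \<open>p m\<close> would survive to
    derivative \<open>n\<close>, beyond its rank; if \<open>n < m\<close>, the image of
    \<open>p n\<close> would survive beyond rank \<open>n\<close>.\<close>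
  have "m = n"
  proof (rule ccontr)
    assume "m \<noteq> n"
    then consider "Suc m \<le> n" | "Suc n \<le> m" by linarith
    then show False
      using antimono \<open>h (p n) \<in> cb_derivative n F\<close> \<open>h (p n) \<notin> cb_derivative (Suc n) F\<close>
        rank_ge[of m] rank_le[of m] m(2) unfolding F_def by cases (metis subsetD)+
  qed
  with m show "n \<in> S'" by simp
qed

end

section \<open>Cardinality of the space and of its countable subsets\<close>

lemma inj_double_arrow_code:
  "inj (\<lambda>q. {(r::rat, i::nat). of_rat r < pos q \<and> i = side q})"
proof (rule injI)
  fix q q' :: double_arrow
  assume eq: "{(r::rat, i). of_rat r < pos q \<and> i = side q} = {(r, i). of_rat r < pos q' \<and> i = side q'}"
  then have iff: "(of_rat r < pos q \<and> i = side q) \<longleftrightarrow> (of_rat r < pos q' \<and> i = side q')" for r :: rat and i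
    by (auto simp: set_eq_iff)
  \<comment> \<open>The rational -1 lies below every position, so each cut is nonempty and reveals
    the side.\<close>
  have "of_rat (-1) < pos q" using pos_bounds(1)[of q] by simp
  then have side: "side q = side q'" using iff[of "-1" "side q"] by blast
  have "\<not> pos q < pos q'"
  proof
    assume "pos q < pos q'"
    then obtain r where "pos q < of_rat r" "of_rat r < pos q'" using of_rat_dense by blast
    then show False using iff[of r "side q'"] side by auto
  qed
  moreover have "\<not> pos q' < pos q"
  proof
    assume "pos q' < pos q"
    then obtain r where "pos q' < of_rat r" "of_rat r < pos q" using of_rat_dense by blast
    then show False using iff[of r "side q"] side by auto
  qed
  ultimately show "q = q'" using side by (simp add: da_eq_iff)
qed

lemma card_nat_set: "|UNIV :: nat set set| =o ctwo ^c natLeq"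
  using card_of_Pow_Func[of "UNIV :: nat set"]
  by (simp add: cexp_def ctwo_def Field_natLeq Field_card_of)

text \<open>A point is coded by the rational cut of its position tagged with its side, a subset of a
  countable type and hence a set of naturals.\<close>

lemma card_double_arrow: "|UNIV :: double_arrow set| \<le>o ctwo ^c natLeq"
proof -
  let ?f = "\<lambda>q. to_nat ` {(r::rat, i::nat). of_rat r < pos q \<and> i = side q}"
  have "inj ?f"
    using inj_double_arrow_code by (auto simp: inj_def inj_image_eq_iff)
  then have "|UNIV :: double_arrow set| \<le>o |UNIV :: nat set set|"
    by (intro card_of_ordLeqI[of ?f]) auto
  then show ?thesis using card_nat_set by (rule ordLeq_ordIso_trans)
qed

text \<open>Each nonempty countable set is the range of a sequence, and there are at most
  \<c>^\<omega> = \<c> sequences.\<close>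

lemma card_countable_subsets:
  fixes \<D> :: "'a set set"
  assumes "|UNIV :: 'a set| \<le>o ctwo ^c natLeq" and "\<And>D. D \<in> \<D> \<Longrightarrow> countable D \<and> D \<noteq> {}"
  shows "|\<D>| \<le>o ctwo ^c natLeq"
proof -
  have "\<D> \<subseteq> range (range :: (nat \<Rightarrow> 'a) \<Rightarrow> 'a set)"
  proof
    fix D assume "D \<in> \<D>"
    from assms(2)[OF this] have "range (from_nat_into D) = D" by (simp add: range_from_nat_into)
    then show "D \<in> range (range :: (nat \<Rightarrow> 'a) \<Rightarrow> 'a set)"
      by (intro range_eqI[of _ _ "from_nat_into D"]) simp
  qed
  then have "|\<D>| \<le>o |UNIV :: (nat \<Rightarrow> 'a) set|" by (rule surj_imp_ordLeq)
  also have "|UNIV :: (nat \<Rightarrow> 'a) set| \<le>o |UNIV :: 'a set| ^c natLeq"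
    by (simp add: cexp_def Field_natLeq Field_card_of Func_def ordIso_imp_ordLeq[OF card_of_refl])
  also have "|UNIV :: 'a set| ^c natLeq \<le>o (ctwo ^c natLeq) ^c natLeq"
    using assms(1) natLeq_Card_order by (rule cexp_mono1)
  also have "(ctwo ^c natLeq) ^c natLeq =o ctwo ^c natLeq"
    using natLeq_Cinfinite by (intro cexp_cprod_ordLeq Card_order_ctwo Cinfinite_Cnotzero ordLeq_refl) auto
  finally show ?thesis .
qed

theorem theorem3p3:
  shows "has_types_of_countable_dense (euclidean :: double_arrow topology) (ctwo ^c natLeq)"
proof -
  obtain U V p where "double_arrow_coding U V p"
    using splits_with_all_ranks unfolding double_arrow_coding_def by blast
  then interpret double_arrow_coding U V p .
  let ?X = "euclidean :: double_arrow topology"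
  have dense: "countable_dense_in ?X (code S)" for S
    using countable_coded_set coded_set_dense[OF splits] by (simp add: countable_dense_in_def)
  have lower_bound: "ctwo ^c natLeq \<le>o |\<D>|" if rep: "represents_countable_dense ?X \<D>" for \<D>
  proof -
    \<comment> \<open>Choosing a representative for every code gives a map from sets of naturals to
      \<open>\<D>\<close>; its injectivity is the lower bound.\<close>
    have "\<forall>S. \<exists>D\<in>\<D>. \<exists>h. homeomorphic_map ?X ?X h \<and> h ` D = code S"
      using rep dense unfolding represents_countable_dense_def by blast
    then obtain D h where D: "D S \<in> \<D>" and h: "homeomorphic_map ?X ?X (h S)" "h S ` D S = code S" for S
      by metis
    have "\<forall>S. \<exists>g. continuous_on UNIV (h S) \<and> continuous_on UNIV g \<and> (\<forall>q. g (h S q) = q) \<and> (\<forall>q. h S (g q) = q)"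
      using h(1) unfolding homeomorphic_map_maps homeomorphic_maps_def by auto
    then obtain g where g: "continuous_on UNIV (h S)" "continuous_on UNIV (g S)"
      "g S (h S q) = q" "h S (g S q) = q" for S q by metis
    \<comment> \<open>If two codes share a representative, passing through it gives a homeomorphism
      between the codes.\<close>
    have sub: "S \<subseteq> S'" if "D S = D S'" for S S'
    proof (rule code_determined)
      show "continuous_on UNIV (h S' \<circ> g S)" "continuous_on UNIV (h S \<circ> g S')"
        by (rule continuous_on_compose[OF g(2) continuous_on_subset[OF g(1) subset_UNIV]])+
      show "(h S \<circ> g S') ((h S' \<circ> g S) q) = q" "(h S' \<circ> g S) ((h S \<circ> g S') q) = q" for q
        by (simp_all add: g)
      have "g S ` code S = D S" unfolding h(2)[symmetric] image_image g by simp
      then show "(h S' \<circ> g S) ` code S = code S'" using h(2)[of S'] that by (metis image_comp)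
    qed
    then have "inj D" by (intro injI subset_antisym) auto
    then have "|UNIV :: nat set set| \<le>o |\<D>|" using D by (intro card_of_ordLeqI[of D]) auto
    with ordIso_symmetric[OF card_nat_set] show ?thesis by (rule ordIso_ordLeq_trans)
  qed
  \<comment> \<open>For the upper bound all countable dense sets are taken, each representing itself
    by the identity.\<close>
  let ?D = "{D. countable_dense_in ?X D}"
  have rep: "represents_countable_dense ?X ?D"
    unfolding represents_countable_dense_def
  proof (intro conjI ballI allI impI)
    fix E assume "countable_dense_in ?X E"
    then show "\<exists>D\<in>?D. \<exists>h. homeomorphic_map ?X ?X h \<and> h ` D = E"
      by (intro bexI[of _ E] exI[of _ id]) (simp_all add: homeomorphic_map_id)
  qed simp
  have "|?D| \<le>o ctwo ^c natLeq"
    by (intro card_countable_subsets card_double_arrow) (auto simp: countable_dense_in_def)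
  with lower_bound[OF rep] have "|?D| =o ctwo ^c natLeq"
    by (simp add: ordIso_iff_ordLeq)
  with rep dense lower_bound show ?thesis
    unfolding has_types_of_countable_dense_def separable_topology_def
    by (auto simp: Card_order_cexp)
qed

end
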